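(* Consider the setting where the set of alternatives equals the set $C$ of $n$ agents, with metric $d$, and let $k,\ell\in\{1,\dots,n\}$. Let $B>0$ satisfy $B\ge\mathrm{OPT}_\ell$. If the order $x_1,\dots,x_n$ of the agents is uniformly random, then the set $S$ output by the algorithm Meyerson-Top$_\ell$ (with estimate $B$) satisfies $$\mathbb E[|S|]\le 26k\qquad\text{and}\qquad\mathbb E\bigl[\mathrm{Top}_\ell(d(C,S))\bigr]\le 15B+14\,\mathrm{OPT}_\ell .$$
   Context: $C$ is a finite set of $n$ agents with a pseudometric $d$ (distinct points may be at distance $0$). For $\emptyset\neq S\subseteq C$, $d(i,S)=\min_{a\in S}d(i,a)$ and $d(C,S)=(d(i,S))_{i\in C}$. $\mathrm{Top}_\ell(v)$ is the sum of the $\ell$ largest entries of $v$. $\mathrm{OPT}_\ell=\min\{\mathrm{Top}_\ell(d(C,S)):S\subseteq C,1\le|S|\le k\}$. Write $z^+=\max\{z,0\}$. Algorithm Meyerson-Top$_\ell$ (input: a sequence $x_1,\dots,x_n$ enumerating the agents of $C$, and $B$): set $S\leftarrow\{x_1\}$ and $f=B/k$. For $i=2,\dots,n$ in order: compute $\delta_i=\bigl(d(x_i,S)-3\cdot\frac B\ell\bigr)^+$ with respect to the current $S$, and, with probability $\min(1,\delta_i/f)$ (independent fresh randomness), add $x_i$ to $S$. Output the final $S$. *)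

theory Defs
  imports "HOL-Probability.Probability"
begin

definition pseudometric_on :: "'a set \<Rightarrow> ('a \<Rightarrow> 'a \<Rightarrow> real) \<Rightarrow> bool" where
  "pseudometric_on C d \<longleftrightarrow>
     (\<forall>x\<in>C. \<forall>y\<in>C. 0 \<le> d x y) \<and>
     (\<forall>x\<in>C. d x x = 0) \<and>
     (\<forall>x\<in>C. \<forall>y\<in>C. d x y = d y x) \<and>
     (\<forall>x\<in>C. \<forall>y\<in>C. \<forall>z\<in>C. d x z \<le> d x y + d y z)"

text \<open>\<open>setdist_min d i S\<close> is meaningful only for finite nonempty \<open>S\<close>.\<close>

definition setdist_min :: "('a \<Rightarrow> 'a \<Rightarrow> real) \<Rightarrow> 'a \<Rightarrow> 'a set \<Rightarrow> real" where
  "setdist_min d i S = Min (d i ` S)"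

text \<open>
  A vector indexed by a finite set \<open>I\<close> is a function \<open>v\<close> restricted to \<open>I\<close>. Its entries form
  a multiset, so that equal entries at different indices are counted separately.
\<close>

definition Top :: "nat \<Rightarrow> 'a set \<Rightarrow> ('a \<Rightarrow> real) \<Rightarrow> real" where
  "Top l I v = sum_list (take l (rev (sorted_list_of_multiset (image_mset v (mset_set I)))))"

definition top_cost :: "'a set \<Rightarrow> ('a \<Rightarrow> 'a \<Rightarrow> real) \<Rightarrow> nat \<Rightarrow> 'a set \<Rightarrow> real" where
  "top_cost C d l S = Top l C (\<lambda>i. setdist_min d i S)"

definition OPT :: "'a set \<Rightarrow> ('a \<Rightarrow> 'a \<Rightarrow> real) \<Rightarrow> nat \<Rightarrow> nat \<Rightarrow> real" where
  "OPT C d k l = Min {top_cost C d l S | S. S \<subseteq> C \<and> 1 \<le> card S \<and> card S \<le> k}"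

definition meyerson_delta ::
  "('a \<Rightarrow> 'a \<Rightarrow> real) \<Rightarrow> nat \<Rightarrow> real \<Rightarrow> 'a set \<Rightarrow> 'a \<Rightarrow> real" where
  "meyerson_delta d l B S x = max (setdist_min d x S - 3 * (B / real l)) 0"

primrec meyerson_loop ::
  "('a \<Rightarrow> 'a \<Rightarrow> real) \<Rightarrow> nat \<Rightarrow> real \<Rightarrow> real \<Rightarrow> 'a list \<Rightarrow> 'a set \<Rightarrow> 'a set pmf" where
  "meyerson_loop d l B f [] S = return_pmf S"
| "meyerson_loop d l B f (x # xs) S =
     bind_pmf (bernoulli_pmf (min 1 (meyerson_delta d l B S x / f)))
       (\<lambda>b. meyerson_loop d l B f xs (if b then insert x S else S))"

text \<open>The input sequence is required to be nonempty.\<close>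

definition meyerson_top ::
  "('a \<Rightarrow> 'a \<Rightarrow> real) \<Rightarrow> nat \<Rightarrow> nat \<Rightarrow> real \<Rightarrow> 'a list \<Rightarrow> 'a set pmf" where
  "meyerson_top d k l B xs = meyerson_loop d l B (B / real k) (tl xs) {hd xs}"

text \<open>
  The order is drawn uniformly among the duplicate-free lists enumerating \<open>C\<close>; the coin flips
  of the algorithm are independent of it.
\<close>

definition meyerson_top_random_order ::
  "'a set \<Rightarrow> ('a \<Rightarrow> 'a \<Rightarrow> real) \<Rightarrow> nat \<Rightarrow> nat \<Rightarrow> real \<Rightarrow> 'a set pmf" where
  "meyerson_top_random_order C d k l B =
     bind_pmf (pmf_of_set (permutations_of_set C)) (meyerson_top d k l B)"

end

theory Submission
  imports Defs
begin

text \<open>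
  Charge an agent \<open>x\<close> arriving at the open set \<open>S\<close> the amount \<open>min \<delta> f\<close>. A charge divided by \<open>f\<close> is an
  opening probability, and the charge dominates the expected excess \<open>\<delta>\<close> left when \<open>x\<close> is not opened;
  so both claims follow once the expected total charge is at most \<open>3 * B + 10 * OPT\<close>.

  Fix an optimal solution, and let \<open>A\<close> be the sum of the distances exceeding \<open>t = B / l\<close> from the
  \<open>c\<close> points of one of its clusters to the centre. The near points, at distance at most
  \<open>t + 2 * A / c\<close>, form at least half of the cluster. Until one of them is opened they are charged
  \<open>f\<close> in expectation, and afterwards at most \<open>4 * A / c\<close> each, for every order: the
  threshold \<open>3 * t\<close> absorbs the rest. A far point at distance \<open>r\<close> is charged at most \<open>2 * r\<close> more than
  any near point would be, and in a random order the near points are at least as numerous, so that the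
  far charges are paid for by the near ones. This amortisation is carried out with a
  potential that is a supermartingale under uniformly random draws from the remaining points.
\<close>

section \<open>Sums of the largest entries and thresholds\<close>

text \<open>Each taken entry \<open>y\<close> is at most \<open>\<tau> + max (y - \<tau>) 0\<close>,
  and the entries left out contribute nonnegative terms. If fewer than \<open>l\<close> entries
  exist, \<open>\<tau> \<ge> 0\<close> pays for the missing ones.\<close>

lemma sum_list_take_le_threshold:
  fixes ys :: "real list"
  assumes "\<tau> \<ge> 0"
  shows "sum_list (take l ys) \<le> real l * \<tau> + (\<Sum>y\<leftarrow>ys. max (y - \<tau>) 0)"
proof (induction ys arbitrary: l)
  case Nil
  then show ?case using assms by simp
next
  case (Cons y ys)
  show ?case
  proof (cases l)
    case 0
    have "0 \<le> (\<Sum>y\<leftarrow>y # ys. max (y - \<tau>) 0)"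
      by (rule sum_list_nonneg) auto
    then show ?thesis using 0 by simp
  next
    case (Suc m)
    then show ?thesis using Cons.IH[of m] by (simp add: algebra_simps)
  qed
qed

lemma sum_list_take_mono:
  fixes ys :: "real list"
  assumes "\<And>y. y \<in> set ys \<Longrightarrow> 0 \<le> y" "m \<le> l"
  shows "sum_list (take m ys) \<le> sum_list (take l ys)"
proof -
  have "take l ys = take m ys @ take (l - m) (drop m ys)"
    using assms(2) by (metis le_add_diff_inverse take_add)
  moreover have "0 \<le> sum_list (take (l - m) (drop m ys))"
    using assms(1) by (intro sum_list_nonneg) (meson in_set_dropD in_set_takeD)
  ultimately show ?thesis by simp
qed

lemma filter_eq_takeWhile_antimono:
  fixes ys :: "real list"
  assumes "sorted_wrt (\<ge>) ys"
  shows "filter (\<lambda>y. y > t) ys = takeWhile (\<lambda>y. y > t) ys"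
  using assms
proof (induction ys)
  case (Cons y ys)
  have "filter (\<lambda>y. y > t) ys = []" if "\<not> y > t"
    using Cons.prems that by (force simp: filter_empty_conv)
  then show ?case using Cons by auto
qed simp

text \<open>In decreasing order the entries above \<open>t\<close> form a prefix. Were it longer
  than \<open>l\<close>, the first \<open>l\<close> entries would already sum to more than
  \<open>l * t\<close>.\<close>

lemma sum_list_filter_le_take:
  fixes ys :: "real list"
  assumes "sorted_wrt (\<ge>) ys" "\<And>y. y \<in> set ys \<Longrightarrow> 0 \<le> y"
    and "0 < l" "sum_list (take l ys) \<le> real l * t"
  shows "sum_list (filter (\<lambda>y. y > t) ys) \<le> sum_list (take l ys)"
proof -
  define m where "m = length (takeWhile (\<lambda>y. y > t) ys)"
  have m: "filter (\<lambda>y. y > t) ys = take m ys"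
    unfolding m_def using filter_eq_takeWhile_antimono[OF assms(1)]
    by (metis takeWhile_eq_take)
  have "m \<le> l"
  proof (rule ccontr)
    assume "\<not> m \<le> l"
    then have lm: "l < m" by simp
    have len: "m \<le> length ys" unfolding m_def by (simp add: length_takeWhile_le)
    have "(\<Sum>i<l. t) < (\<Sum>i<l. ys ! i)"
    proof (rule sum_strict_mono)
      fix i assume "i \<in> {..<l}"
      then have "i < m" using lm by simp
      then show "t < ys ! i" unfolding m_def
        by (metis nth_mem set_takeWhileD takeWhile_nth)
    qed (use \<open>0 < l\<close> in auto)
    also have "(\<Sum>i<l. ys ! i) = sum_list (take l ys)"
      using lm len by (simp add: sum_list_sum_nth atLeast0LessThan)
    finally show False using assms(4) by simp
  qed
  then show ?thesis using sum_list_take_mono[OF assms(2)] m by simp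
qed

lemma sum_list_map_rev_sorted_list_of_multiset:
  assumes "finite I"
  shows "sum_list (map g (rev (sorted_list_of_multiset (image_mset v (mset_set I)))))
           = (\<Sum>i\<in>I. (g (v i) :: real))"
proof -
  have "sum_list (map g (rev (sorted_list_of_multiset (image_mset v (mset_set I)))))
      = sum_mset (mset (map g (rev (sorted_list_of_multiset (image_mset v (mset_set I))))))"
    by (simp only: sum_mset_sum_list)
  also have "\<dots> = (\<Sum>i\<in>I. g (v i))"
    using assms by (simp add: image_mset.compositionality comp_def sum_unfold_sum_mset)
  finally show ?thesis .
qed

lemma Top_le_threshold:
  assumes "finite I" "\<tau> \<ge> 0"
  shows "Top l I v \<le> real l * \<tau> + (\<Sum>i\<in>I. max (v i - \<tau>) 0)"
  using sum_list_take_le_threshold[OF assms(2), of l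
      "rev (sorted_list_of_multiset (image_mset v (mset_set I)))"]
  unfolding Top_def
  using sum_list_map_rev_sorted_list_of_multiset[OF assms(1), of "\<lambda>y. max (y - \<tau>) 0" v] by simp

text \<open>With \<open>t = B / l\<close> this bounds the long distances of an optimal solution by
  \<open>OPT\<close>; it is how \<open>B \<ge> OPT\<close> enters the analysis of the
  clusters.\<close>

lemma sum_above_threshold_le_Top:
  assumes "finite I" "\<And>i. i \<in> I \<Longrightarrow> 0 \<le> v i" "0 < l" "Top l I v \<le> real l * t"
  shows "(\<Sum>i\<in>{i\<in>I. v i > t}. v i) \<le> Top l I v"
proof -
  let ?ys = "rev (sorted_list_of_multiset (image_mset v (mset_set I)))"
  have "(\<Sum>i\<in>{i\<in>I. v i > t}. v i) = (\<Sum>i\<in>I. if v i > t then v i else 0)"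
    using assms(1) by (simp add: sum.inter_filter)
  also have "\<dots> = (\<Sum>y\<leftarrow>?ys. if y > t then y else 0)"
    using sum_list_map_rev_sorted_list_of_multiset[OF assms(1), of "\<lambda>y. if y > t then y else 0" v]
    by simp
  also have "\<dots> = sum_list (filter (\<lambda>y. y > t) ?ys)"
    using sum_list_map_filter'[of "\<lambda>y. y" "\<lambda>y. y > t" ?ys] by simp
  also have "\<dots> \<le> sum_list (take l ?ys)"
  proof (rule sum_list_filter_le_take)
    show "sorted_wrt (\<ge>) ?ys" by (simp add: sorted_wrt_rev)
  next
    fix y assume "y \<in> set ?ys"
    then show "0 \<le> y" using assms(1,2) by auto
  qed (use assms(3,4) in \<open>auto simp: Top_def\<close>)
  finally show ?thesis unfolding Top_def .
qed

section \<open>Runs of the algorithm and their expected charge\<close>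

text \<open>Finite support makes every real function of the output integrable, as linearity and
  monotonicity of the expectation require.\<close>

lemma finite_set_pmf_meyerson_loop: "finite (set_pmf (meyerson_loop d l B f xs S))"
  by (induction xs arbitrary: S) auto

lemma meyerson_loop_supset:
  "T \<in> set_pmf (meyerson_loop d l B f xs S) \<Longrightarrow> S \<subseteq> T \<and> T \<subseteq> S \<union> set xs"
proof (induction xs arbitrary: S)
  case (Cons x xs)
  then obtain b where "T \<in> set_pmf (meyerson_loop d l B f xs (if b then insert x S else S))"
    by auto
  from Cons.IH[OF this] show ?case by (auto split: if_splits)
qed simp

lemma setdist_min_antimono:
  assumes "finite T" "S \<noteq> {}" "S \<subseteq> T"
  shows "setdist_min d x T \<le> setdist_min d x S"
  unfolding setdist_min_def using assms by (intro Min_antimono) auto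

lemma meyerson_delta_nonneg: "0 \<le> meyerson_delta d l B S x"
  unfolding meyerson_delta_def by simp

lemma meyerson_delta_antimono:
  assumes "finite T" "S \<noteq> {}" "S \<subseteq> T"
  shows "meyerson_delta d l B T x \<le> meyerson_delta d l B S x"
  unfolding meyerson_delta_def using setdist_min_antimono[OF assms, of d x] by auto

definition meyerson_charge ::
  "('a \<Rightarrow> 'a \<Rightarrow> real) \<Rightarrow> nat \<Rightarrow> real \<Rightarrow> real \<Rightarrow> 'a set \<Rightarrow> 'a \<Rightarrow> real" where
  "meyerson_charge d l B f S x = min (meyerson_delta d l B S x) f"

text \<open>
  For \<open>f > 0\<close>, \<open>meyerson_charge d l B f S x / f\<close> is the probability \<open>min 1 (\<delta> / f)\<close> that \<open>x\<close> is opened.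
\<close>

primrec expected_charge ::
  "('a \<Rightarrow> 'a \<Rightarrow> real) \<Rightarrow> nat \<Rightarrow> real \<Rightarrow> real \<Rightarrow> 'a list \<Rightarrow> 'a set \<Rightarrow> real" where
  "expected_charge d l B f [] S = 0"
| "expected_charge d l B f (x # xs) S =
     meyerson_charge d l B f S x
     + meyerson_charge d l B f S x / f * expected_charge d l B f xs (insert x S)
     + (1 - meyerson_charge d l B f S x / f) * expected_charge d l B f xs S"

lemma meyerson_charge_bounds:
  assumes "f > 0"
  shows "0 \<le> meyerson_charge d l B f S x" "meyerson_charge d l B f S x \<le> f"
    "0 \<le> meyerson_charge d l B f S x / f" "meyerson_charge d l B f S x / f \<le> 1"
  using assms meyerson_delta_nonneg[of d l B S x] unfolding meyerson_charge_def by auto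

lemma meyerson_charge_antimono:
  assumes "finite T" "S \<noteq> {}" "S \<subseteq> T"
  shows "meyerson_charge d l B f T x \<le> meyerson_charge d l B f S x"
  unfolding meyerson_charge_def using meyerson_delta_antimono[OF assms, of d l B x] by auto

lemma expectation_meyerson_loop_Cons:
  fixes d :: "'a \<Rightarrow> 'a \<Rightarrow> real" and l :: nat and B f :: real and S :: "'a set" and x :: 'a
    and h :: "'a set \<Rightarrow> real"
  assumes "f > 0"
  defines "p \<equiv> meyerson_charge d l B f S x / f"
  shows "measure_pmf.expectation (meyerson_loop d l B f (x # xs) S) h
    = p * measure_pmf.expectation (meyerson_loop d l B f xs (insert x S)) h
      + (1 - p) * measure_pmf.expectation (meyerson_loop d l B f xs S) h"
proof -
  have p: "min 1 (meyerson_delta d l B S x / f) = p"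
    using assms(1) unfolding p_def meyerson_charge_def by (auto simp: min_def field_simps)
  have "0 \<le> p" "p \<le> 1" unfolding p_def by (rule meyerson_charge_bounds[OF assms(1)])+
  then show ?thesis
    unfolding meyerson_loop.simps p
    by (subst pmf_expectation_bind[of UNIV]) (auto simp: UNIV_bool finite_set_pmf_meyerson_loop)
qed

text \<open>Every arrival enlarges the set by at most one, with probability charge over
  \<open>f\<close>. It is only an inequality because an arriving point might already lie in
  \<open>S\<close>.\<close>

lemma expectation_card_meyerson_loop:
  assumes "f > 0" "finite S"
  shows "measure_pmf.expectation (meyerson_loop d l B f xs S) (\<lambda>T. real (card T))
           \<le> real (card S) + expected_charge d l B f xs S / f"
  using assms(2)
proof (induction xs arbitrary: S)
  case (Cons x xs)
  define p where "p = meyerson_charge d l B f S x / f"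
  define G1 where "G1 = expected_charge d l B f xs (insert x S)"
  define G0 where "G0 = expected_charge d l B f xs S"
  have p: "0 \<le> p" "p \<le> 1" unfolding p_def by (rule meyerson_charge_bounds[OF assms(1)])+
  have "measure_pmf.expectation (meyerson_loop d l B f xs (insert x S)) (\<lambda>T. real (card T))
        \<le> real (card (insert x S)) + G1 / f"
    unfolding G1_def using Cons.IH[of "insert x S"] Cons.prems by simp
  also have "\<dots> \<le> real (card S) + 1 + G1 / f"
    using card_insert_le_m1[of "Suc (card S)" S x] by simp
  finally have 1: "measure_pmf.expectation (meyerson_loop d l B f xs (insert x S))
        (\<lambda>T. real (card T)) \<le> real (card S) + 1 + G1 / f" .
  have 0: "measure_pmf.expectation (meyerson_loop d l B f xs S) (\<lambda>T. real (card T))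
        \<le> real (card S) + G0 / f"
    unfolding G0_def using Cons by simp
  have "measure_pmf.expectation (meyerson_loop d l B f (x # xs) S) (\<lambda>T. real (card T))
      \<le> p * (real (card S) + 1 + G1 / f) + (1 - p) * (real (card S) + G0 / f)"
    unfolding expectation_meyerson_loop_Cons[OF assms(1)] p_def[symmetric]
    using p 0 1 by (intro add_mono mult_left_mono) auto
  also have "\<dots> = real (card S) + expected_charge d l B f (x # xs) S / f"
    unfolding expected_charge.simps p_def G1_def G0_def 
    by (simp add: algebra_simps add_divide_distrib diff_divide_distrib)
  finally show ?case .
qed simp

lemma expectation_mono_pmf:
  fixes g h :: "'b \<Rightarrow> real"
  assumes "finite (set_pmf p)" "\<And>x. x \<in> set_pmf p \<Longrightarrow> g x \<le> h x"
  shows "measure_pmf.expectation p g \<le> measure_pmf.expectation p h"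
  using assms by (intro integral_mono_AE)
    (auto intro: integrable_measure_pmf_finite simp: AE_measure_pmf_iff)

lemma setdist_min_self:
  assumes "pseudometric_on C d" "finite S" "S \<subseteq> C" "x \<in> S"
  shows "setdist_min d x S = 0"
proof -
  have "setdist_min d x S \<le> d x x"
    unfolding setdist_min_def using assms by (intro Min_le) auto
  moreover have "0 \<le> setdist_min d x S"
  proof -
    have "0 \<le> d x y" if "y \<in> S" for y
      using assms(1,3,4) that unfolding pseudometric_on_def by (meson subsetD)
    moreover have "d x ` S \<noteq> {}" using assms(4) by blast
    ultimately show ?thesis unfolding setdist_min_def using assms(2) by simp
  qed
  moreover have "d x x = 0"
    using assms(1,3,4) unfolding pseudometric_on_def by (meson subsetD)
  ultimately show ?thesis by simp
qed

lemma meyerson_delta_self: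
  assumes "pseudometric_on C d" "finite S" "S \<subseteq> C" "x \<in> S" "B \<ge> 0"
  shows "meyerson_delta d l B S x = 0"
  unfolding meyerson_delta_def using setdist_min_self[OF assms(1-4)] assms(5) by simp

text \<open>A point that gets opened ends with excess 0. A point that is passed over ends with at
  most its excess on arrival, since the open set only grows. So the arrival of \<open>x\<close>
  costs at most \<open>(1 - p)\<close> times its excess at that moment.\<close>

lemma expectation_delta_meyerson_loop:
  assumes "f > 0" "B \<ge> 0" "pseudometric_on C d" "finite S" "S \<noteq> {}" "S \<subseteq> C"
    and "set xs \<subseteq> C" "distinct xs"
  shows "measure_pmf.expectation (meyerson_loop d l B f xs S)
           (\<lambda>T. \<Sum>x\<in>set xs. meyerson_delta d l B T x) \<le> expected_charge d l B f xs S"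
  using assms(4-8)
proof (induction xs arbitrary: S)
  case (Cons x xs)
  define p where "p = meyerson_charge d l B f S x / f"
  let ?G1 = "expected_charge d l B f xs (insert x S)"
  let ?G0 = "expected_charge d l B f xs S"
  let ?E = "\<lambda>S. measure_pmf.expectation (meyerson_loop d l B f xs S)"
  let ?h = "\<lambda>T. \<Sum>y\<in>set (x # xs). meyerson_delta d l B T y"
  let ?h' = "\<lambda>T. \<Sum>y\<in>set xs. meyerson_delta d l B T y"
  note fin = finite_set_pmf_meyerson_loop
  have p: "0 \<le> p" "p \<le> 1" unfolding p_def by (rule meyerson_charge_bounds[OF assms(1)])+
  have h: "?h T = meyerson_delta d l B T x + ?h' T" for T
    using Cons.prems by simp
  have "?E (insert x S) ?h \<le> ?E (insert x S) ?h'"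
  proof (rule expectation_mono_pmf[OF fin])
    fix T assume "T \<in> set_pmf (meyerson_loop d l B f xs (insert x S))"
    from meyerson_loop_supset[OF this] have T: "insert x S \<subseteq> T" "T \<subseteq> insert x S \<union> set xs"
      by auto
    have "T \<subseteq> C" using T(2) Cons.prems(3,4) by auto
    moreover have "finite T" using T(2) by (rule finite_subset) (use Cons.prems(1) in simp)
    ultimately have "insert x S \<subseteq> T" "T \<subseteq> C" "finite T" using T(1) by auto
    then show "?h T \<le> ?h' T"
      unfolding h using meyerson_delta_self[OF assms(3), of T x B l] assms(2) by auto
  qed
  also have "\<dots> \<le> ?G1" using Cons.prems by (intro Cons.IH) auto
  finally have 1: "?E (insert x S) ?h \<le> ?G1" .
  have "?E S ?h \<le> ?E S (\<lambda>T. meyerson_delta d l B S x + ?h' T)"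
  proof (rule expectation_mono_pmf[OF fin])
    fix T assume "T \<in> set_pmf (meyerson_loop d l B f xs S)"
    from meyerson_loop_supset[OF this] have T: "S \<subseteq> T" "T \<subseteq> S \<union> set xs"
      by auto
    have "finite T" using T(2) by (rule finite_subset) (use Cons.prems(1) in simp)
    then show "?h T \<le> meyerson_delta d l B S x + ?h' T"
      unfolding h using meyerson_delta_antimono[of T S d l B x] Cons.prems(2) T(1) by simp
  qed
  also have "\<dots> = meyerson_delta d l B S x + ?E S ?h'"
    by (subst Bochner_Integration.integral_add) (auto intro: integrable_measure_pmf_finite fin)
  also have "\<dots> \<le> meyerson_delta d l B S x + ?G0"
    using Cons.prems by (intro add_mono Cons.IH) auto
  finally have 0: "?E S ?h \<le> meyerson_delta d l B S x + ?G0" .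
  \<comment> \<open>If the excess is at most \<open>f\<close>, the charge equals it; if it is
    larger, then \<open>p = 1\<close> and the left side vanishes.\<close>
  have miss: "(1 - p) * meyerson_delta d l B S x \<le> meyerson_charge d l B f S x"
  proof (cases "meyerson_delta d l B S x \<le> f")
    case True
    then have "meyerson_charge d l B f S x = meyerson_delta d l B S x"
      unfolding meyerson_charge_def by simp
    then show ?thesis using p meyerson_delta_nonneg[of d l B S x]
      by (simp add: mult_left_le_one_le)
  next
    case False
    then show ?thesis using assms(1) unfolding p_def meyerson_charge_def by simp
  qed
  have "measure_pmf.expectation (meyerson_loop d l B f (x # xs) S) ?h
      \<le> p * ?G1 + (1 - p) * (meyerson_delta d l B S x + ?G0)"
    unfolding expectation_meyerson_loop_Cons[OF assms(1)] p_def[symmetric]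
    using p 0 1 by (intro add_mono mult_left_mono) auto
  also have "\<dots> \<le> expected_charge d l B f (x # xs) S"
    unfolding expected_charge.simps p_def[symmetric] using miss by (simp add: algebra_simps)
  finally show ?case .
qed simp

section \<open>Averaging over random orders\<close>

lemma sum_permutations_of_set_Cons:
  assumes "finite A" "A \<noteq> {}"
  shows "(\<Sum>xs\<in>permutations_of_set A. g xs)
    = (\<Sum>x\<in>A. \<Sum>xs\<in>permutations_of_set (A - {x}). (g (x # xs) :: real))"
proof -
  have disj: "(#) x ` permutations_of_set (A - {x}) \<inter> (#) y ` permutations_of_set (A - {y}) = {}"
    if "x \<noteq> y" for x y
    using that by auto
  have "(\<Sum>xs\<in>permutations_of_set A. g xs)
    = (\<Sum>x\<in>A. sum g ((#) x ` permutations_of_set (A - {x})))"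
    unfolding permutations_of_set_nonempty[OF assms(2)]
    using assms(1) disj by (intro sum.UNION_disjoint) auto
  also have "\<dots> = (\<Sum>x\<in>A. \<Sum>xs\<in>permutations_of_set (A - {x}). g (x # xs))"
    by (rule sum.cong[OF refl]) (simp add: sum.reindex)
  finally show ?thesis .
qed

text \<open>The supermartingale argument, with sums over orders in place of expectations. A uniform
  order is a uniform first element followed by a uniform order of the rest, so \<open>step\<close>
  says that the charge plus the expected later potential stays below the current potential.
  \<open>I\<close> is an invariant carrying the side conditions on \<open>R\<close> and
  \<open>S\<close>.\<close>

lemma sum_permutations_expected_charge_le:
  assumes "f > 0" "finite R"
    and step: "\<And>R S. finite R \<Longrightarrow> R \<noteq> {} \<Longrightarrow> I R S \<Longrightarrow>
      (\<Sum>x\<in>R. meyerson_charge d l B f S x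
         + meyerson_charge d l B f S x / f * W (R - {x}) (insert x S)
         + (1 - meyerson_charge d l B f S x / f) * W (R - {x}) S) \<le> real (card R) * W R S"
    and inv: "\<And>R S x. I R S \<Longrightarrow> x \<in> R \<Longrightarrow> I (R - {x}) S \<and> I (R - {x}) (insert x S)"
    and nonneg: "\<And>S. I {} S \<Longrightarrow> 0 \<le> W {} S"
    and "I R S"
  shows "(\<Sum>xs\<in>permutations_of_set R. expected_charge d l B f xs S) \<le> fact (card R) * W R S"
  using assms(2,6)
proof (induction "card R" arbitrary: R S)
  case 0
  then show ?case using nonneg by simp
next
  case (Suc n)
  then have "R \<noteq> {}" by auto
  define q where "q x = meyerson_charge d l B f S x" for x
  have "(\<Sum>xs\<in>permutations_of_set R. expected_charge d l B f xs S)
    = (\<Sum>x\<in>R. \<Sum>xs\<in>permutations_of_set (R - {x}). expected_charge d l B f (x # xs) S)"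
    by (rule sum_permutations_of_set_Cons[OF Suc.prems(1) \<open>R \<noteq> {}\<close>])
  also have "\<dots> \<le> (\<Sum>x\<in>R. fact n *
      (q x + q x / f * W (R - {x}) (insert x S) + (1 - q x / f) * W (R - {x}) S))"
  proof (rule sum_mono)
    fix x assume x: "x \<in> R"
    have n: "n = card (R - {x})" using Suc x by simp
    have q: "0 \<le> q x / f" "q x / f \<le> 1"
      unfolding q_def by (rule meyerson_charge_bounds[OF assms(1)])+
    have "(\<Sum>xs\<in>permutations_of_set (R - {x}). expected_charge d l B f (x # xs) S)
      = fact n * q x
        + q x / f * (\<Sum>xs\<in>permutations_of_set (R - {x}). expected_charge d l B f xs (insert x S))
        + (1 - q x / f) * (\<Sum>xs\<in>permutations_of_set (R - {x}). expected_charge d l B f xs S)"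
      using Suc.prems n by (simp add: sum.distrib sum_distrib_left q_def)
    also have "\<dots> \<le> fact n * q x + q x / f * (fact n * W (R - {x}) (insert x S))
        + (1 - q x / f) * (fact n * W (R - {x}) S)"
      using q Suc.hyps(1)[OF n] Suc.prems inv[OF Suc.prems(2) x] n
      by (intro add_mono mult_left_mono) auto
    finally show "(\<Sum>xs\<in>permutations_of_set (R - {x}). expected_charge d l B f (x # xs) S)
      \<le> fact n * (q x + q x / f * W (R - {x}) (insert x S) + (1 - q x / f) * W (R - {x}) S)"
      by (simp add: algebra_simps)
  qed
  also have "\<dots> \<le> fact n * (real (card R) * W R S)"
    unfolding sum_distrib_left[symmetric] q_def
    using step[OF Suc.prems(1) \<open>R \<noteq> {}\<close> Suc.prems(2)] by (intro mult_left_mono) auto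
  also have "\<dots> = fact (card R) * W R S"
    by (simp add: Suc.hyps(2)[symmetric] algebra_simps)
  finally show ?case .
qed

section \<open>The potential of a single cluster\<close>

text \<open>Charges never exceed \<open>f\<close>, so inserting \<open>f\<close> changes the minimum
  only for empty \<open>Q\<close>, where it supplies a value.\<close>

definition least_charge ::
  "('a \<Rightarrow> 'a \<Rightarrow> real) \<Rightarrow> nat \<Rightarrow> real \<Rightarrow> real \<Rightarrow> 'a set \<Rightarrow> 'a set \<Rightarrow> real" where
  "least_charge d l B f Q S = Min (insert f (meyerson_charge d l B f S ` Q))"

text \<open>A bound on the charges still to come from near points: \<open>f\<close> for the expected
  charge until one of them is opened, and \<open>\<kappa>\<close> for each one drawn after
  that.\<close>

definition near_potential ::
  "real \<Rightarrow> real \<Rightarrow> 'a set \<Rightarrow> 'a set \<Rightarrow> 'a set \<Rightarrow> real" where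
  "near_potential f \<kappa> Q R S = (if S \<inter> Q = {} then f else 0) + \<kappa> * real (card (Q \<inter> R))"

text \<open>
  Here \<open>Q\<close> and \<open>F\<close> are the near and far points of a cluster, \<open>R\<close> the points not yet drawn, and
  \<open>a\<close>, \<open>b\<close> the numbers of undrawn near and far points. Under uniform draws \<open>b / (a + 1)\<close>, the
  expected number of far points drawn before the next near point, is a martingale while \<open>a > 0\<close>.
\<close>

definition cluster_potential ::
  "('a \<Rightarrow> 'a \<Rightarrow> real) \<Rightarrow> nat \<Rightarrow> real \<Rightarrow> real \<Rightarrow> ('a \<Rightarrow> real) \<Rightarrow> real \<Rightarrow> 'a set \<Rightarrow> 'a set
     \<Rightarrow> 'a set \<Rightarrow> 'a set \<Rightarrow> real" where
  "cluster_potential d l B f r \<kappa> Q F R S =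
     (let a = real (card (Q \<inter> R)); b = real (card (F \<inter> R)) in
      ((a + b + 1) * near_potential f \<kappa> Q R S + b * least_charge d l B f Q S) / (a + 1)
      + 2 * (\<Sum>x\<in>F \<inter> R. r x))"

lemma least_charge_nonneg:
  assumes "f > 0" "finite Q"
  shows "0 \<le> least_charge d l B f Q S"
  unfolding least_charge_def using assms meyerson_charge_bounds(1)[OF assms(1)] by auto

lemma least_charge_le:
  assumes "finite Q" "x \<in> Q"
  shows "least_charge d l B f Q S \<le> meyerson_charge d l B f S x"
  unfolding least_charge_def using assms by (intro Min_le) auto

lemma least_charge_antimono:
  assumes "finite Q" "finite T" "S \<noteq> {}" "S \<subseteq> T"
  shows "least_charge d l B f Q T \<le> least_charge d l B f Q S"
proof -
  have "Min (insert f (meyerson_charge d l B f T ` Q)) \<le> y"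
    if y: "y \<in> insert f (meyerson_charge d l B f S ` Q)" for y
  proof (cases "y = f")
    case True
    then show ?thesis using assms(1) by (intro Min_le) auto
  next
    case False
    then obtain q where q: "q \<in> Q" "y = meyerson_charge d l B f S q" using y by auto
    have "Min (insert f (meyerson_charge d l B f T ` Q)) \<le> meyerson_charge d l B f T q"
      using assms(1) q(1) by (intro Min_le) auto
    also have "\<dots> \<le> y" unfolding q(2) by (rule meyerson_charge_antimono[OF assms(2-4)])
    finally show ?thesis .
  qed
  then show ?thesis unfolding least_charge_def using assms(1) by (subst Min_ge_iff) auto
qed

lemma near_potential_nonneg: "f > 0 \<Longrightarrow> \<kappa> \<ge> 0 \<Longrightarrow> 0 \<le> near_potential f \<kappa> Q R S"
  unfolding near_potential_def by simp

lemma near_potential_insert_le: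
  "f > 0 \<Longrightarrow> near_potential f \<kappa> Q R (insert x S) \<le> near_potential f \<kappa> Q R S"
  unfolding near_potential_def by auto

text \<open>A larger open set lowers the least charge and can only remove the summand
  \<open>f\<close>. Hence openings outside the near points never hurt a cluster.\<close>

lemma cluster_potential_insert_le:
  assumes "f > 0" "finite Q" "finite S" "S \<noteq> {}"
  shows "cluster_potential d l B f r \<kappa> Q F R (insert x S) \<le> cluster_potential d l B f r \<kappa> Q F R S"
  unfolding cluster_potential_def Let_def
  using least_charge_antimono[of Q "insert x S" S d l B f] assms
    near_potential_insert_le[OF assms(1), of \<kappa> Q R x S]
  by (intro add_mono divide_right_mono mult_left_mono) auto

lemma cluster_potential_remove_other:
  assumes "x \<notin> Q" "x \<notin> F"
  shows "cluster_potential d l B f r \<kappa> Q F (R - {x}) S = cluster_potential d l B f r \<kappa> Q F R S"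
proof -
  have "Q \<inter> (R - {x}) = Q \<inter> R" "F \<inter> (R - {x}) = F \<inter> R" using assms by auto
  then show ?thesis unfolding cluster_potential_def near_potential_def by simp
qed

lemma cluster_potential_nonneg:
  assumes "f > 0" "\<kappa> \<ge> 0" "finite Q" "\<And>x. x \<in> F \<Longrightarrow> 0 \<le> r x"
  shows "0 \<le> cluster_potential d l B f r \<kappa> Q F R S"
  unfolding cluster_potential_def Let_def
  using near_potential_nonneg[OF assms(1,2)] least_charge_nonneg[OF assms(1,3)] assms(4)
  by (intro add_nonneg_nonneg divide_nonneg_nonneg mult_nonneg_nonneg sum_nonneg) auto

text \<open>The near potential falls by at least \<open>q\<close> in expectation: without an open
  near point, opening \<open>x\<close> with probability \<open>q / f\<close> removes
  \<open>f\<close>; otherwise \<open>\<kappa> \<ge> q\<close> is released because \<open>x\<close>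
  is drawn. The least charge becomes 0 if \<open>x\<close> is opened, and its expectation after the
  draw is at most \<open>q\<close>. Combining the two,
  \<open>q + ((a + b) * (\<Phi> - q) + b * q) / a\<close> with \<open>\<Phi>\<close> the near
  potential, all terms in \<open>q\<close> cancel.\<close>

lemma cluster_potential_draw_near:
  assumes "f > 0" "\<kappa> \<ge> 0" "finite Q" "Q \<inter> F = {}" "x \<in> Q \<inter> R"
    and self: "meyerson_charge d l B f (insert x S) x = 0"
    and near: "S \<inter> Q \<noteq> {} \<Longrightarrow> meyerson_charge d l B f S x \<le> \<kappa>"
  defines "a \<equiv> real (card (Q \<inter> R))" and "b \<equiv> real (card (F \<inter> R))"
    and "q \<equiv> meyerson_charge d l B f S x"
  shows "q + q / f * cluster_potential d l B f r \<kappa> Q F (R - {x}) (insert x S)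
           + (1 - q / f) * cluster_potential d l B f r \<kappa> Q F (R - {x}) S
         \<le> (a + b) * near_potential f \<kappa> Q R S / a + 2 * (\<Sum>x\<in>F \<inter> R. r x)"
proof -
  let ?\<Phi> = "near_potential f \<kappa> Q R S"
  define p where "p = q / f"
  define \<Phi>1 where "\<Phi>1 = near_potential f \<kappa> Q (R - {x}) (insert x S)"
  define \<Phi>0 where "\<Phi>0 = near_potential f \<kappa> Q (R - {x}) S"
  define u where "u = least_charge d l B f Q S"
  have p: "0 \<le> p" "p \<le> 1" "q = p * f" "0 \<le> q"
    using meyerson_charge_bounds[OF assms(1), of d l B S x] assms(1)
    unfolding p_def q_def by simp_all
  have QR: "Q \<inter> (R - {x}) = Q \<inter> R - {x}" and FR: "F \<inter> (R - {x}) = F \<inter> R"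
    using assms(4,5) by auto
  have "0 < card (Q \<inter> R)" using assms(3,5) by (auto simp: card_gt_0_iff)
  then have a: "real (card (Q \<inter> (R - {x}))) = a - 1" "1 \<le> a"
    unfolding QR a_def using assms(3,5) by (auto simp: of_nat_diff)
  have u1: "least_charge d l B f Q (insert x S) = 0"
    using least_charge_nonneg[OF assms(1,3), of d l B "insert x S"] self
      least_charge_le[OF assms(3), of x d l B f "insert x S"] assms(5) by auto
  have "(1 - p) * u \<le> (1 - p) * q"
    using least_charge_le[OF assms(3), of x d l B f S] assms(5) p
    unfolding u_def q_def by (intro mult_left_mono) auto
  also have "\<dots> \<le> q" using p by (simp add: mult_left_le_one_le)
  finally have u: "(1 - p) * u \<le> q" .
  have \<Phi>1: "\<Phi>1 = \<kappa> * (a - 1)"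
    unfolding \<Phi>1_def near_potential_def a(1) using assms(5) by auto
  have \<Phi>0: "\<Phi>0 = ?\<Phi> - \<kappa>"
    unfolding \<Phi>0_def near_potential_def a(1) a_def[symmetric] by (simp add: algebra_simps)
  have \<Phi>: "p * \<Phi>1 + (1 - p) * \<Phi>0 \<le> ?\<Phi> - q"
  proof (cases "S \<inter> Q = {}")
    case True
    then have "?\<Phi> = f + \<kappa> * a" unfolding near_potential_def a_def by simp
    then show ?thesis unfolding \<Phi>1 \<Phi>0 p(3) using assms(2) by (simp add: algebra_simps)
  next
    case False
    then have "?\<Phi> = \<kappa> * a" unfolding near_potential_def a_def by simp
    then have "p * \<Phi>1 + (1 - p) * \<Phi>0 = ?\<Phi> - \<kappa>" unfolding \<Phi>1 \<Phi>0 by (simp add: algebra_simps)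
    then show ?thesis using near[OF False] unfolding q_def by simp
  qed
  have "q + p * cluster_potential d l B f r \<kappa> Q F (R - {x}) (insert x S)
           + (1 - p) * cluster_potential d l B f r \<kappa> Q F (R - {x}) S
      = q + ((a + b) * (p * \<Phi>1 + (1 - p) * \<Phi>0) + b * ((1 - p) * u)) / a
        + 2 * (\<Sum>x\<in>F \<inter> R. r x)"
    unfolding cluster_potential_def Let_def FR a(1) u1 b_def[symmetric] \<Phi>1_def[symmetric]
      \<Phi>0_def[symmetric] u_def[symmetric]
    using a(2) by (simp add: field_simps)
  also have "\<dots> \<le> q + ((a + b) * (?\<Phi> - q) + b * q) / a + 2 * (\<Sum>x\<in>F \<inter> R. r x)"
    using \<Phi> u a(2) unfolding b_def
    by (intro add_mono divide_right_mono mult_left_mono) auto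
  also have "\<dots> = (a + b) * ?\<Phi> / a + 2 * (\<Sum>x\<in>F \<inter> R. r x)"
    using a(2) by (simp add: field_simps)
  finally show ?thesis unfolding p_def .
qed

text \<open>The part \<open>2 * r x\<close> of the charge is released from the sum over undrawn far
  points. The other part, the least charge \<open>u\<close>, merges with the remaining
  \<open>(b - 1) * u / (a + 1)\<close> into \<open>(a + b) * u / (a + 1)\<close>.\<close>

lemma cluster_potential_draw_far:
  assumes "f > 0" "\<kappa> \<ge> 0" "finite Q" "finite F" "Q \<inter> F = {}" "x \<in> F \<inter> R" "finite S" "S \<noteq> {}"
    and far: "meyerson_charge d l B f S x \<le> 2 * r x + least_charge d l B f Q S"
  defines "a \<equiv> real (card (Q \<inter> R))" and "b \<equiv> real (card (F \<inter> R))"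
    and "q \<equiv> meyerson_charge d l B f S x"
  shows "q + q / f * cluster_potential d l B f r \<kappa> Q F (R - {x}) (insert x S)
           + (1 - q / f) * cluster_potential d l B f r \<kappa> Q F (R - {x}) S
         \<le> (a + b) * (near_potential f \<kappa> Q R S + least_charge d l B f Q S) / (a + 1)
            + 2 * (\<Sum>x\<in>F \<inter> R. r x)"
proof -
  let ?W = "cluster_potential d l B f r \<kappa> Q F"
  define \<Phi> where "\<Phi> = near_potential f \<kappa> Q R S"
  define u where "u = least_charge d l B f Q S"
  have q: "0 \<le> q / f" unfolding q_def by (rule meyerson_charge_bounds[OF assms(1)])
  have QR: "Q \<inter> (R - {x}) = Q \<inter> R" and FR: "F \<inter> (R - {x}) = F \<inter> R - {x}"
    using assms(5,6) by auto
  have "0 < card (F \<inter> R)" using assms(4,6) by (auto simp: card_gt_0_iff)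
  then have b: "real (card (F \<inter> (R - {x}))) = b - 1"
    unfolding FR b_def using assms(4,6) by (auto simp: of_nat_diff)
  have sum: "(\<Sum>x\<in>F \<inter> (R - {x}). r x) = (\<Sum>x\<in>F \<inter> R. r x) - r x"
    unfolding FR using assms(4,6) by (simp add: sum_diff1)
  have "0 \<le> a" unfolding a_def by simp
  have "near_potential f \<kappa> Q (R - {x}) S = \<Phi>"
    unfolding \<Phi>_def near_potential_def QR by simp
  then have W: "?W (R - {x}) S
      = ((a + b) * \<Phi> + (b - 1) * u) / (a + 1) + 2 * ((\<Sum>x\<in>F \<inter> R. r x) - r x)"
    unfolding cluster_potential_def Let_def QR b sum a_def[symmetric] u_def by simp
  \<comment> \<open>Opening the far point only lowers the potential, so it suffices to treat the
    draw as if \<open>x\<close> stayed closed.\<close>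
  have "q / f * ?W (R - {x}) (insert x S) \<le> q / f * ?W (R - {x}) S"
    using cluster_potential_insert_le[OF assms(1,3,7,8)] q by (intro mult_left_mono) auto
  then have "q + q / f * ?W (R - {x}) (insert x S) + (1 - q / f) * ?W (R - {x}) S
      \<le> q + ?W (R - {x}) S"
    by (simp add: algebra_simps)
  also have "\<dots> \<le> u + ((a + b) * \<Phi> + (b - 1) * u) / (a + 1) + 2 * (\<Sum>x\<in>F \<inter> R. r x)"
    unfolding W using far unfolding q_def u_def by (simp add: algebra_simps)
  also have "\<dots> = (a + b) * (\<Phi> + u) / (a + 1) + 2 * (\<Sum>x\<in>F \<inter> R. r x)"
    using \<open>0 \<le> a\<close> by (simp add: field_simps)
  finally show ?thesis unfolding \<Phi>_def u_def .
qed

text \<open>Adding \<open>a\<close> near bounds and \<open>b\<close> far bounds gives exactly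
  \<open>(a + b) * W R S\<close> when \<open>a > 0\<close>; this balance dictates the shape of the
  potential.\<close>

lemma cluster_potential_draw:
  assumes "f > 0" "\<kappa> \<ge> 0" "finite Q" "finite F" "Q \<inter> F = {}" "finite S" "S \<noteq> {}"
    and self: "\<And>x. x \<in> Q \<Longrightarrow> meyerson_charge d l B f (insert x S) x = 0"
    and near: "\<And>x. x \<in> Q \<Longrightarrow> S \<inter> Q \<noteq> {} \<Longrightarrow> meyerson_charge d l B f S x \<le> \<kappa>"
    and far: "\<And>x. x \<in> F \<Longrightarrow> meyerson_charge d l B f S x \<le> 2 * r x + least_charge d l B f Q S"
  defines "W \<equiv> cluster_potential d l B f r \<kappa> Q F"
  shows "(\<Sum>x\<in>(Q \<union> F) \<inter> R. meyerson_charge d l B f S x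
           + meyerson_charge d l B f S x / f * W (R - {x}) (insert x S)
           + (1 - meyerson_charge d l B f S x / f) * W (R - {x}) S)
         \<le> real (card ((Q \<union> F) \<inter> R)) * W R S"
proof -
  define g where "g x = meyerson_charge d l B f S x
           + meyerson_charge d l B f S x / f * W (R - {x}) (insert x S)
           + (1 - meyerson_charge d l B f S x / f) * W (R - {x}) S" for x
  define a where "a = real (card (Q \<inter> R))"
  define b where "b = real (card (F \<inter> R))"
  define \<Phi> where "\<Phi> = near_potential f \<kappa> Q R S"
  define u where "u = least_charge d l B f Q S"
  define s where "s = 2 * (\<Sum>x\<in>F \<inter> R. r x)"
  have nonneg: "0 \<le> a" "0 \<le> b" "0 \<le> \<Phi>" "0 \<le> u"
    unfolding a_def b_def \<Phi>_def u_def
    using near_potential_nonneg[OF assms(1,2)] least_charge_nonneg[OF assms(1,3)] by auto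
  have QF: "(Q \<union> F) \<inter> R = (Q \<inter> R) \<union> (F \<inter> R)" "(Q \<inter> R) \<inter> (F \<inter> R) = {}"
    "finite (Q \<inter> R)" "finite (F \<inter> R)"
    using assms(3-5) by auto
  have W: "W R S = ((a + b + 1) * \<Phi> + b * u) / (a + 1) + s"
    unfolding W_def cluster_potential_def Let_def a_def b_def \<Phi>_def u_def s_def by simp
  have "(\<Sum>x\<in>Q \<inter> R. g x) \<le> (\<Sum>x\<in>Q \<inter> R. (a + b) * \<Phi> / a + s)"
  proof (rule sum_mono)
    fix x assume "x \<in> Q \<inter> R"
    then show "g x \<le> (a + b) * \<Phi> / a + s"
      unfolding g_def W_def a_def b_def \<Phi>_def s_def using assms(1-5) self near
      by (intro cluster_potential_draw_near) auto
  qed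
  then have Q: "(\<Sum>x\<in>Q \<inter> R. g x) \<le> a * ((a + b) * \<Phi> / a + s)" by (simp add: a_def)
  have "(\<Sum>x\<in>F \<inter> R. g x) \<le> (\<Sum>x\<in>F \<inter> R. (a + b) * (\<Phi> + u) / (a + 1) + s)"
  proof (rule sum_mono)
    fix x assume "x \<in> F \<inter> R"
    then show "g x \<le> (a + b) * (\<Phi> + u) / (a + 1) + s"
      unfolding g_def W_def a_def b_def \<Phi>_def s_def u_def using assms(1-7) far
      by (intro cluster_potential_draw_far) auto
  qed
  then have F: "(\<Sum>x\<in>F \<inter> R. g x) \<le> b * ((a + b) * (\<Phi> + u) / (a + 1) + s)" by (simp add: b_def)
  have "(\<Sum>x\<in>(Q \<union> F) \<inter> R. g x) = (\<Sum>x\<in>Q \<inter> R. g x) + (\<Sum>x\<in>F \<inter> R. g x)"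
    unfolding QF(1) by (rule sum.union_disjoint[OF QF(3,4,2)])
  also have "\<dots> \<le> a * ((a + b) * \<Phi> / a + s) + b * ((a + b) * (\<Phi> + u) / (a + 1) + s)"
    using Q F by (rule add_mono)
  also have "\<dots> \<le> (a + b) * W R S"
  \<comment> \<open>With no near point left only the far bounds count, and their sum falls short of
    the right side by \<open>b * \<Phi>\<close>.\<close>
  proof (cases "a = 0")
    case True
    have "0 \<le> b * \<Phi>" using nonneg by simp
    then show ?thesis unfolding W using True by (simp add: algebra_simps)
  next
    case False
    then have "0 < a" using nonneg by simp
    have 1: "a * ((a + b) * \<Phi> / a) = (a + b) * \<Phi>" using \<open>0 < a\<close> by simp
    have "a * ((a + b) * \<Phi> / a + s) + b * ((a + b) * (\<Phi> + u) / (a + 1) + s)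
        = (a + b) * (\<Phi> + b * (\<Phi> + u) / (a + 1) + s)"
      unfolding distrib_left[of a] 1 by (simp add: algebra_simps)
    also have "\<Phi> + b * (\<Phi> + u) / (a + 1) + s = W R S"
      unfolding W using \<open>0 < a\<close> by (simp add: field_simps)
    finally show ?thesis by simp
  qed
  also have "a + b = real (card ((Q \<union> F) \<inter> R))"
    unfolding QF(1) a_def b_def using card_Un_disjoint[OF QF(3,4,2)] by simp
  finally show ?thesis unfolding g_def .
qed

section \<open>Initial potential, sum over clusters, and metric estimates\<close>

lemma setdist_min_attained:
  assumes "finite S" "S \<noteq> {}"
  obtains a where "a \<in> S" "setdist_min d x S = d x a"
proof -
  have "setdist_min d x S \<in> d x ` S"
    unfolding setdist_min_def using assms by (intro Min_in) auto
  then show ?thesis using that by auto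
qed

lemma setdist_min_le:
  assumes "finite S" "a \<in> S"
  shows "setdist_min d x S \<le> d x a"
  unfolding setdist_min_def using assms by (intro Min_le) auto

text \<open>Since \<open>b \<le> a + 1\<close>, the fraction is at most
  \<open>2 * \<Phi> + u\<close>, where \<open>\<Phi> \<le> f + \<kappa> * card Q\<close> and
  \<open>u \<le> f\<close>.\<close>

lemma cluster_potential_start_le:
  assumes "f > 0" "\<kappa> \<ge> 0" "finite Q" "finite F" "\<And>x. x \<in> F \<Longrightarrow> 0 \<le> r x"
    and "card F \<le> card Q" "Q \<subseteq> C"
  shows "cluster_potential d l B f r \<kappa> Q F (C - {x}) S
    \<le> 3 * f + 2 * (\<kappa> * real (card Q)) + 2 * (\<Sum>x\<in>F. r x)"
proof -
  define a where "a = real (card (Q \<inter> (C - {x})))"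
  define b where "b = real (card (F \<inter> (C - {x})))"
  define \<Phi> where "\<Phi> = near_potential f \<kappa> Q (C - {x}) S"
  define u where "u = least_charge d l B f Q S"
  have nonneg: "0 \<le> \<Phi>" "0 \<le> u" "0 \<le> a" "0 \<le> b"
    unfolding a_def b_def \<Phi>_def u_def
    using near_potential_nonneg[OF assms(1,2)] least_charge_nonneg[OF assms(1,3)] by auto
  have "u \<le> f" unfolding u_def least_charge_def using assms(3) by (intro Min_le) auto
  have a: "a \<le> real (card Q)" unfolding a_def using assms(3) by (simp add: card_mono)
  have "\<Phi> \<le> f + \<kappa> * real (card Q)"
    unfolding \<Phi>_def near_potential_def a_def[symmetric]
    using assms(1,2) a by (intro add_mono mult_left_mono) auto
  have "b \<le> real (card F)" unfolding b_def using assms(4) by (simp add: card_mono)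
  also have "\<dots> \<le> real (card Q)" using assms(6) by simp
  \<comment> \<open>The agent \<open>x\<close> removed at the start may itself be near; the
    \<open>+ 1\<close> in the denominator of the potential absorbs this loss.\<close>
  also have "\<dots> \<le> a + 1"
  proof -
    have "Q \<inter> (C - {x}) = Q - {x}" using assms(7) by auto
    then show ?thesis unfolding a_def
      by (cases "x \<in> Q") (auto simp: card_Diff_singleton)
  qed
  finally have "b \<le> a + 1" .
  have "((a + b + 1) * \<Phi> + b * u) / (a + 1) = \<Phi> + b / (a + 1) * (\<Phi> + u)"
    using nonneg by (simp add: field_simps)
  also have "b / (a + 1) * (\<Phi> + u) \<le> 1 * (\<Phi> + u)"
    using \<open>b \<le> a + 1\<close> nonneg by (intro mult_right_mono) auto
  also have "\<Phi> + 1 * (\<Phi> + u) \<le> 3 * f + 2 * (\<kappa> * real (card Q))"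
    using \<open>u \<le> f\<close> \<open>\<Phi> \<le> f + \<kappa> * real (card Q)\<close> by simp
  finally have "((a + b + 1) * \<Phi> + b * u) / (a + 1) \<le> 3 * f + 2 * (\<kappa> * real (card Q))"
    by simp
  moreover have "(\<Sum>x\<in>F \<inter> (C - {x}). r x) \<le> (\<Sum>x\<in>F. r x)"
    using assms(4,5) by (intro sum_mono2) auto
  ultimately show ?thesis
    unfolding cluster_potential_def Let_def a_def b_def \<Phi>_def u_def by simp
qed

text \<open>The charge of \<open>x\<close> is attributed to its own cluster \<open>\<phi> x\<close>.
  Every other cluster keeps its undrawn points and feels the draw only through a possible opening,
  which cannot raise its potential.\<close>

lemma sum_cluster_potential_draw:
  fixes W :: "'b \<Rightarrow> 'a set \<Rightarrow> 'a set \<Rightarrow> real" and q p :: "'a \<Rightarrow> real"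
  assumes "finite R" "finite J" "\<phi> ` R \<subseteq> J"
    and p: "\<And>x. x \<in> R \<Longrightarrow> 0 \<le> p x"
    and own: "\<And>j. j \<in> J \<Longrightarrow>
      (\<Sum>x\<in>{x\<in>R. \<phi> x = j}. q x + p x * W j (R - {x}) (insert x S) + (1 - p x) * W j (R - {x}) S)
        \<le> real (card {x\<in>R. \<phi> x = j}) * W j R S"
    and other: "\<And>j x. j \<in> J \<Longrightarrow> x \<in> R \<Longrightarrow> \<phi> x \<noteq> j \<Longrightarrow> W j (R - {x}) S = W j R S"
    and insert: "\<And>j x. j \<in> J \<Longrightarrow> x \<in> R \<Longrightarrow> W j (R - {x}) (insert x S) \<le> W j (R - {x}) S"
  shows "(\<Sum>x\<in>R. q x + p x * (\<Sum>j\<in>J. W j (R - {x}) (insert x S))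
            + (1 - p x) * (\<Sum>j\<in>J. W j (R - {x}) S))
         \<le> real (card R) * (\<Sum>j\<in>J. W j R S)"
proof -
  define g where "g j x = p x * W j (R - {x}) (insert x S) + (1 - p x) * W j (R - {x}) S" for j x
  have own': "(\<Sum>x\<in>R. (if \<phi> x = j then q x else 0) + g j x) \<le> real (card R) * W j R S"
    if j: "j \<in> J" for j
  proof -
    have R: "{x\<in>R. \<phi> x = j} \<union> {x\<in>R. \<phi> x \<noteq> j} = R" by auto
    have "(\<Sum>x\<in>R. (if \<phi> x = j then q x else 0) + g j x)
      = (\<Sum>x\<in>{x\<in>R. \<phi> x = j}. q x + g j x) + (\<Sum>x\<in>{x\<in>R. \<phi> x \<noteq> j}. g j x)"
    proof -
      have "(\<Sum>x\<in>R. (if \<phi> x = j then q x else 0) + g j x)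
        = (\<Sum>x\<in>{x\<in>R. \<phi> x = j} \<union> {x\<in>R. \<phi> x \<noteq> j}. (if \<phi> x = j then q x else 0) + g j x)"
        unfolding R ..
      also have "\<dots> = (\<Sum>x\<in>{x\<in>R. \<phi> x = j}. q x + g j x) + (\<Sum>x\<in>{x\<in>R. \<phi> x \<noteq> j}. g j x)"
        using assms(1) by (subst sum.union_disjoint) auto
      finally show ?thesis .
    qed
    also have "(\<Sum>x\<in>{x\<in>R. \<phi> x \<noteq> j}. g j x) \<le> (\<Sum>x\<in>{x\<in>R. \<phi> x \<noteq> j}. W j R S)"
    proof (rule sum_mono)
      fix x assume x: "x \<in> {x\<in>R. \<phi> x \<noteq> j}"
      have "g j x \<le> p x * W j (R - {x}) S + (1 - p x) * W j (R - {x}) S"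
        unfolding g_def using p insert[OF j] x
        by (intro add_right_mono mult_left_mono) auto
      also have "\<dots> = W j (R - {x}) S" by (simp add: algebra_simps)
      finally show "g j x \<le> W j R S" using other[OF j] x by simp
    qed
    finally have "(\<Sum>x\<in>R. (if \<phi> x = j then q x else 0) + g j x)
      \<le> real (card {x\<in>R. \<phi> x = j}) * W j R S + (\<Sum>x\<in>{x\<in>R. \<phi> x \<noteq> j}. W j R S)"
      using own[OF j] unfolding g_def by (simp add: add.assoc)
    also have "\<dots> = real (card {x\<in>R. \<phi> x = j} + card {x\<in>R. \<phi> x \<noteq> j}) * W j R S"
      by (simp add: algebra_simps)
    also have "card {x\<in>R. \<phi> x = j} + card {x\<in>R. \<phi> x \<noteq> j} = card R"
      using card_Un_disjoint[of "{x\<in>R. \<phi> x = j}" "{x\<in>R. \<phi> x \<noteq> j}"] assms(1) R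
      by (simp add: disjoint_iff)
    finally show ?thesis .
  qed
  have "(\<Sum>x\<in>R. q x + p x * (\<Sum>j\<in>J. W j (R - {x}) (insert x S))
            + (1 - p x) * (\<Sum>j\<in>J. W j (R - {x}) S))
      = (\<Sum>x\<in>R. \<Sum>j\<in>J. (if \<phi> x = j then q x else 0) + g j x)"
  proof (rule sum.cong[OF refl])
    fix x assume "x \<in> R"
    then have "(\<Sum>j\<in>J. if \<phi> x = j then q x else 0) = q x" using assms(2,3) by auto
    then show "q x + p x * (\<Sum>j\<in>J. W j (R - {x}) (insert x S))
            + (1 - p x) * (\<Sum>j\<in>J. W j (R - {x}) S)
         = (\<Sum>j\<in>J. (if \<phi> x = j then q x else 0) + g j x)"
      unfolding g_def by (simp add: sum.distrib sum_distrib_left)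
  qed
  also have "\<dots> = (\<Sum>j\<in>J. \<Sum>x\<in>R. (if \<phi> x = j then q x else 0) + g j x)"
    by (rule sum.swap)
  also have "\<dots> \<le> (\<Sum>j\<in>J. real (card R) * W j R S)"
    using own' by (rule sum_mono)
  finally show ?thesis by (simp add: sum_distrib_left)
qed

text \<open>Markov's inequality: points beyond \<open>\<rho>\<close> also exceed \<open>t\<close>,
  so their distances sum to at most \<open>A\<close>, while each is larger than
  \<open>2 * A / card K\<close>. They are therefore at most half of \<open>K\<close>.\<close>

lemma card_above_average_le:
  fixes r :: "'a \<Rightarrow> real"
  assumes "finite K" "t > 0" "\<And>x. x \<in> K \<Longrightarrow> 0 \<le> r x"
  defines "A \<equiv> (\<Sum>x\<in>{x\<in>K. r x > t}. r x)"
  defines "\<rho> \<equiv> t + 2 * A / real (card K)"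
  shows "card {x\<in>K. \<not> r x \<le> \<rho>} \<le> card {x\<in>K. r x \<le> \<rho>}"
    and "(\<Sum>x\<in>{x\<in>K. \<not> r x \<le> \<rho>}. r x) \<le> A"
proof -
  let ?F = "{x\<in>K. \<not> r x \<le> \<rho>}"
  let ?c = "real (card K)"
  have A: "0 \<le> A" unfolding A_def using assms(2) by (intro sum_nonneg) auto
  have \<rho>: "t \<le> \<rho>" unfolding \<rho>_def using A by simp
  show F: "(\<Sum>x\<in>?F. r x) \<le> A"
    unfolding A_def using assms(1,3) \<rho> by (intro sum_mono2) auto
  have "{x\<in>K. r x \<le> \<rho>} \<union> ?F = K" by auto
  then have K: "card {x\<in>K. r x \<le> \<rho>} + card ?F = card K"
    using card_Un_disjoint[of "{x\<in>K. r x \<le> \<rho>}" ?F] assms(1) by (simp add: disjoint_iff)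
  show "card ?F \<le> card {x\<in>K. r x \<le> \<rho>}"
  proof (cases "?F = {}")
    case False
    then have c: "0 < ?c" using assms(1) by (auto simp: card_gt_0_iff)
    have "real (card ?F) * (2 * A / ?c) = (\<Sum>x\<in>?F. 2 * A / ?c)" by simp
    also have "\<dots> < (\<Sum>x\<in>?F. r x)"
      using False assms(1,2) by (intro sum_strict_mono) (auto simp: \<rho>_def)
    also note F
    finally have less: "real (card ?F) * (2 * A / ?c) < A" .
    \<comment> \<open>For \<open>A = 0\<close> the strict inequality would read
      \<open>0 < 0\<close>; strictness comes from \<open>t > 0\<close>.\<close>
    then have "0 < A" using A by (cases "A = 0") auto
    with less c have "2 * real (card ?F) < ?c" by (simp add: field_simps)
    then show ?thesis using K by linarith
  qed (simp only: card.empty)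
qed

lemma meyerson_delta_triangle:
  assumes "pseudometric_on C d" "finite S" "S \<noteq> {}" "S \<subseteq> C" "x \<in> C" "y \<in> C"
  shows "meyerson_delta d l B S x \<le> d x y + meyerson_delta d l B S y"
proof -
  obtain a where a: "a \<in> S" "setdist_min d y S = d y a"
    using setdist_min_attained[OF assms(2,3)] .
  have "setdist_min d x S \<le> d x a" by (rule setdist_min_le[OF assms(2) a(1)])
  also have "\<dots> \<le> d x y + setdist_min d y S"
    unfolding a(2) using assms a(1) unfolding pseudometric_on_def by (meson subsetD)
  finally have "setdist_min d x S \<le> d x y + setdist_min d y S" .
  moreover have "0 \<le> d x y" using assms(1,5,6) unfolding pseudometric_on_def by blast
  ultimately show ?thesis unfolding meyerson_delta_def by auto
qed

text \<open>The excess is 1-Lipschitz in the agent, and capping at \<open>f\<close> preserves the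
  estimate; the element \<open>f\<close> of the minimum is handled by
  \<open>D \<ge> 0\<close>.\<close>

lemma meyerson_charge_le_least_charge:
  assumes "pseudometric_on C d" "finite S" "S \<noteq> {}" "S \<subseteq> C" "x \<in> C" "finite Q" "Q \<subseteq> C"
    and "\<And>y. y \<in> Q \<Longrightarrow> d x y \<le> D" "0 \<le> D"
  shows "meyerson_charge d l B f S x \<le> D + least_charge d l B f Q S"
proof -
  have "meyerson_charge d l B f S x - D \<le> z"
    if z: "z \<in> insert f (meyerson_charge d l B f S ` Q)" for z
  proof (cases "z = f")
    case True
    then show ?thesis using assms(9) unfolding meyerson_charge_def by simp
  next
    case False
    then obtain y where y: "y \<in> Q" "z = meyerson_charge d l B f S y" using z by auto
    have "y \<in> C" using y(1) assms(7) by auto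
    then show ?thesis
      using meyerson_delta_triangle[OF assms(1-5), of y l B] assms(8)[OF y(1)] assms(9)
      unfolding y(2) meyerson_charge_def by linarith
  qed
  then have "meyerson_charge d l B f S x - D \<le> least_charge d l B f Q S"
    unfolding least_charge_def using assms(6) by (subst Min_ge_iff) auto
  then show ?thesis by simp
qed

section \<open>Total expected charge in a random order\<close>

text \<open>The potential is summed over the clusters of nearest centres in \<open>J\<close>.
  Cluster \<open>j\<close> starts with at most \<open>3 * f + 10 * A j\<close>:
  \<open>8 * A j\<close> comes from \<open>2 * \<kappa> j * card (Q j)\<close> and
  \<open>2 * A j\<close> from the far distances.\<close>

lemma sum_random_order_expected_charge_le:
  fixes C :: "'a set"
  assumes fin: "finite C" and pm: "pseudometric_on C d" and J: "J \<subseteq> C" "J \<noteq> {}"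
    and pos: "l > 0" "B > 0" "f > 0" and "z \<in> C"
    and P: "(\<Sum>x\<in>{x\<in>C. setdist_min d x J > B / real l}. setdist_min d x J) \<le> P"
  shows "(\<Sum>xs\<in>permutations_of_set (C - {z}). expected_charge d l B f xs {z})
    \<le> fact (card (C - {z})) * (3 * f * real (card J) + 10 * P)"
proof -
  define t where "t = B / real l"
  have t: "t > 0" unfolding t_def using pos by simp
  define r where "r x = setdist_min d x J" for x
  have finJ: "finite J" using fin J(1) by (rule rev_finite_subset)
  have "\<exists>j. j \<in> J \<and> r x = d x j" for x
    unfolding r_def using setdist_min_attained[OF finJ J(2)] by metis
  then obtain \<phi> where \<phi>: "\<And>x. \<phi> x \<in> J" "\<And>x. r x = d x (\<phi> x)" by metis
  have d_nonneg: "0 \<le> d x y" if "x \<in> C" "y \<in> C" for x y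
    using pm that unfolding pseudometric_on_def by blast
  have r_nonneg: "0 \<le> r x" if "x \<in> C" for x
    unfolding \<phi>(2) using d_nonneg that \<phi>(1) J(1) by blast
  have tri: "d x y \<le> r x + r y" if "x \<in> C" "y \<in> C" "\<phi> x = \<phi> y" for x y
  proof -
    have c: "\<phi> x \<in> C" using \<phi>(1) J(1) by blast
    have "d x y \<le> d x (\<phi> x) + d (\<phi> x) y"
      using pm that(1,2) c unfolding pseudometric_on_def by blast
    also have "d (\<phi> x) y = d y (\<phi> y)"
      using pm that(2,3) c unfolding pseudometric_on_def by metis
    finally show ?thesis unfolding \<phi>(2) .
  qed
  define K where "K j = {x\<in>C. \<phi> x = j}" for j
  define A where "A j = (\<Sum>x\<in>{x\<in>K j. r x > t}. r x)" for j
  define \<rho> where "\<rho> j = t + 2 * A j / real (card (K j))" for j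
  define Q where "Q j = {x\<in>K j. r x \<le> \<rho> j}" for j
  define F where "F j = {x\<in>K j. \<not> r x \<le> \<rho> j}" for j
  \<comment> \<open>Clusters may be empty; division by zero then makes \<open>\<rho> j = t\<close> and \<open>\<kappa> j = 0\<close>.\<close>
  define \<kappa> where "\<kappa> j = 4 * A j / real (card (K j))" for j
  define W where "W j = cluster_potential d l B f r (\<kappa> j) (Q j) (F j)" for j
  have K: "finite (K j)" "K j \<subseteq> C" for j unfolding K_def using fin by auto
  have A: "0 \<le> A j" for j unfolding A_def using t by (intro sum_nonneg) auto
  have \<kappa>: "0 \<le> \<kappa> j" for j unfolding \<kappa>_def using A by simp
  have QF: "finite (Q j)" "finite (F j)" "Q j \<inter> F j = {}" "Q j \<union> F j = K j" for j
    unfolding Q_def F_def using K(1) by auto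
  have FQ: "card (F j) \<le> card (Q j)" and FA: "(\<Sum>x\<in>F j. r x) \<le> A j" for j
    using card_above_average_le[OF K(1) t, of j r] r_nonneg K(2)
    unfolding F_def Q_def \<rho>_def A_def by blast+
  have sumA: "(\<Sum>j\<in>J. A j) \<le> P"
  proof -
    have "(\<Sum>j\<in>J. A j) = (\<Sum>j\<in>J. \<Sum>x\<in>{x\<in>{x\<in>C. r x > t}. \<phi> x = j}. r x)"
      unfolding A_def K_def by (intro sum.cong refl) auto
    also have "\<dots> = (\<Sum>x\<in>{x\<in>C. r x > t}. r x)"
      using fin finJ \<phi>(1) by (intro sum.group) auto
    finally show ?thesis using P unfolding r_def t_def by simp
  qed
  have start: "(\<Sum>j\<in>J. W j (C - {z}) {z}) \<le> 3 * f * real (card J) + 10 * P"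
  proof -
    have "W j (C - {z}) {z} \<le> 3 * f + 10 * A j" for j
    proof -
      have "W j (C - {z}) {z} \<le> 3 * f + 2 * (\<kappa> j * real (card (Q j))) + 2 * (\<Sum>x\<in>F j. r x)"
        unfolding W_def using pos \<kappa> QF FQ K(2) r_nonneg
        by (intro cluster_potential_start_le) blast+
      moreover have "\<kappa> j * real (card (Q j)) \<le> \<kappa> j * real (card (K j))"
        using \<kappa> K(1) by (intro mult_left_mono) (auto simp: Q_def intro: card_mono)
      moreover have "\<kappa> j * real (card (K j)) \<le> 4 * A j"
        unfolding \<kappa>_def using A[of j] by (cases "card (K j) = 0") auto
      ultimately show ?thesis using FA[of j] by linarith
    qed
    then have "(\<Sum>j\<in>J. W j (C - {z}) {z}) \<le> (\<Sum>j\<in>J. 3 * f + 10 * A j)"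
      by (intro sum_mono)
    also have "\<dots> = 3 * f * real (card J) + 10 * (\<Sum>j\<in>J. A j)"
      by (simp add: sum.distrib sum_distrib_left)
    finally show ?thesis using sumA by simp
  qed
  \<comment> \<open>Inclusion in \<open>C\<close> gives finiteness and the metric axioms;
    nonemptiness of \<open>S\<close> makes \<open>setdist_min\<close> a genuine minimum.\<close>
  define I where "I R S \<longleftrightarrow> R \<subseteq> C \<and> S \<subseteq> C \<and> S \<noteq> {}" for R S :: "'a set"
  have "(\<Sum>xs\<in>permutations_of_set (C - {z}). expected_charge d l B f xs {z})
    \<le> fact (card (C - {z})) * (\<Sum>j\<in>J. W j (C - {z}) {z})"
  proof (rule sum_permutations_expected_charge_le[where I = I and W = "\<lambda>R S. \<Sum>j\<in>J. W j R S"])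
    fix R S :: "'a set"
    assume R: "finite R" and "I R S"
    then have RC: "R \<subseteq> C" and S: "S \<subseteq> C" "S \<noteq> {}" "finite S"
      unfolding I_def using fin by (auto intro: finite_subset)
    show "(\<Sum>x\<in>R. meyerson_charge d l B f S x
         + meyerson_charge d l B f S x / f * (\<Sum>j\<in>J. W j (R - {x}) (insert x S))
         + (1 - meyerson_charge d l B f S x / f) * (\<Sum>j\<in>J. W j (R - {x}) S))
       \<le> real (card R) * (\<Sum>j\<in>J. W j R S)"
    proof (rule sum_cluster_potential_draw[OF R finJ])
      show "\<phi> ` R \<subseteq> J" using \<phi>(1) by auto
    next
      fix j assume "j \<in> J"
      have own: "{x\<in>R. \<phi> x = j} = (Q j \<union> F j) \<inter> R"
        unfolding QF(4) K_def using RC by auto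
      show "(\<Sum>x\<in>{x\<in>R. \<phi> x = j}. meyerson_charge d l B f S x
           + meyerson_charge d l B f S x / f * W j (R - {x}) (insert x S)
           + (1 - meyerson_charge d l B f S x / f) * W j (R - {x}) S)
         \<le> real (card {x\<in>R. \<phi> x = j}) * W j R S"
        unfolding own W_def
      proof (rule cluster_potential_draw[OF pos(3) \<kappa> QF(1-3) S(3,2)])
        fix x assume "x \<in> Q j"
        then have x: "x \<in> C" "\<phi> x = j" "r x \<le> \<rho> j" unfolding Q_def K_def by auto
        have "meyerson_delta d l B (insert x S) x = 0"
          using meyerson_delta_self[OF pm, of "insert x S" x B l] S x(1) pos by auto
        then show "meyerson_charge d l B f (insert x S) x = 0"
          unfolding meyerson_charge_def using pos by simp
        assume "S \<inter> Q j \<noteq> {}"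
        then obtain y where y: "y \<in> S" "y \<in> C" "\<phi> y = j" "r y \<le> \<rho> j"
          unfolding Q_def K_def by auto
        have "setdist_min d x S \<le> d x y" by (rule setdist_min_le[OF S(3) y(1)])
        also have "\<dots> \<le> 2 * \<rho> j" using tri[of x y] x y by simp
        \<comment> \<open>Here \<open>2 * \<rho> j = 2 * t + \<kappa> j\<close>, so two near points
          are within \<open>3 * t + \<kappa> j\<close> of each other and the excess over
          \<open>3 * t\<close> is at most \<open>\<kappa> j\<close>.\<close>
        also have "\<dots> \<le> 3 * t + \<kappa> j" unfolding \<rho>_def \<kappa>_def using t by simp
        finally show "meyerson_charge d l B f S x \<le> \<kappa> j"
          unfolding meyerson_charge_def meyerson_delta_def t_def using \<kappa>[of j] by auto
      next
        fix x assume "x \<in> F j"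
        then have x: "x \<in> C" "\<phi> x = j" "\<rho> j \<le> r x" unfolding F_def K_def by auto
        show "meyerson_charge d l B f S x \<le> 2 * r x + least_charge d l B f (Q j) S"
        proof (rule meyerson_charge_le_least_charge[OF pm S(3,2,1) x(1) QF(1)])
          show "Q j \<subseteq> C" using QF(4) K(2) by blast
          \<comment> \<open>A near \<open>y\<close> is no farther from the common centre than the
            far \<open>x\<close>, so the path through the centre has length at most
            \<open>2 * r x\<close>.\<close>
          show "d x y \<le> 2 * r x" if "y \<in> Q j" for y
            using tri[of x y] x that unfolding Q_def K_def by auto
        qed (use r_nonneg x(1) in simp)
      qed
    next
      fix j x assume "x \<in> R" "\<phi> x \<noteq> j"
      then have "x \<notin> Q j" "x \<notin> F j" unfolding Q_def F_def K_def by auto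
      then show "W j (R - {x}) S = W j R S"
        unfolding W_def by (rule cluster_potential_remove_other)
    next
      fix j x
      show "W j (R - {x}) (insert x S) \<le> W j (R - {x}) S"
        unfolding W_def by (rule cluster_potential_insert_le[OF pos(3) QF(1) S(3,2)])
    qed (rule meyerson_charge_bounds(3)[OF pos(3)])
  next
    fix S
    show "0 \<le> (\<Sum>j\<in>J. W j {} S)"
      unfolding W_def
    proof (intro sum_nonneg cluster_potential_nonneg[OF pos(3) \<kappa> QF(1)])
      fix j x assume "x \<in> F j"
      then show "0 \<le> r x" using r_nonneg K(2) unfolding F_def by auto
    qed
  qed (use fin pos(3) \<open>z \<in> C\<close> in \<open>auto simp: I_def\<close>)
  also have "\<dots> \<le> fact (card (C - {z})) * (3 * f * real (card J) + 10 * P)"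
    using start by (intro mult_left_mono) auto
  finally show ?thesis .
qed

section \<open>The two bounds on the output\<close>

theorem theorem4p9:
  fixes C :: "'a set" and d :: "'a \<Rightarrow> 'a \<Rightarrow> real" and k l :: nat and B :: real
  assumes "finite C"
    and "pseudometric_on C d"
    and "k \<in> {1..card C}"
    and "l \<in> {1..card C}"
    and "B > 0"
    and "B \<ge> OPT C d k l"
  shows "measure_pmf.expectation (meyerson_top_random_order C d k l B) (\<lambda>S. real (card S))
           \<le> 26 * real k
       \<and> measure_pmf.expectation (meyerson_top_random_order C d k l B) (top_cost C d l)
           \<le> 15 * B + 14 * OPT C d k l"
proof -
  define f where "f = B / real k"
  define Z where "Z = OPT C d k l"
  let ?\<S> = "{S. S \<subseteq> C \<and> 1 \<le> card S \<and> card S \<le> k}"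
  let ?\<Pi> = "permutations_of_set C"
  have k: "k > 0" and l: "l > 0" and "C \<noteq> {}" using assms(3,4) by auto
  have f: "f > 0" unfolding f_def using k assms(5) by simp
  obtain c where "c \<in> C" using \<open>C \<noteq> {}\<close> by blast
  have "Z \<in> top_cost C d l ` ?\<S>"
  proof -
    have "finite ?\<S>" by (rule finite_subset[of _ "Pow C"]) (use assms(1) in auto)
    moreover have "{c} \<in> ?\<S>" using \<open>c \<in> C\<close> k by simp
    ultimately have "Min (top_cost C d l ` ?\<S>) \<in> top_cost C d l ` ?\<S>"
      by (intro Min_in) blast+
    then show ?thesis unfolding Z_def OPT_def by (simp add: setcompr_eq_image)
  qed
  then obtain J where J: "J \<subseteq> C" "1 \<le> card J" "card J \<le> k" "Z = top_cost C d l J" by auto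
  have "J \<noteq> {}" using J(2) by auto
  have finJ: "finite J" using assms(1) J(1) by (rule rev_finite_subset)
  have dist_nonneg: "0 \<le> setdist_min d x S" if S: "x \<in> C" "S \<subseteq> C" "S \<noteq> {}" for x S
  proof -
    have "finite S" using assms(1) S(2) by (rule rev_finite_subset)
    then obtain a where a: "a \<in> S" "setdist_min d x S = d x a"
      using setdist_min_attained S(3) by metis
    then have "a \<in> C" using S(2) by auto
    then show ?thesis unfolding a(2) using assms(2) S(1) unfolding pseudometric_on_def by blast
  qed
  have P: "(\<Sum>x\<in>{x\<in>C. setdist_min d x J > B / real l}. setdist_min d x J) \<le> Z"
    unfolding J(4) top_cost_def
  proof (rule sum_above_threshold_le_Top[OF assms(1) _ l])
    show "0 \<le> setdist_min d i J" if "i \<in> C" for i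
      using dist_nonneg[OF that J(1) \<open>J \<noteq> {}\<close>] .
    \<comment> \<open>The left side is \<open>OPT\<close>, and the right side is
      \<open>B\<close>.\<close>
    show "Top l C (\<lambda>i. setdist_min d i J) \<le> real l * (B / real l)"
      using assms(6) l J(4) unfolding Z_def top_cost_def by simp
  qed
  have "0 \<le> Z"
  proof -
    have "0 \<le> (\<Sum>x\<in>{x\<in>C. setdist_min d x J > B / real l}. setdist_min d x J)"
      using dist_nonneg J(1) \<open>J \<noteq> {}\<close> by (intro sum_nonneg) auto
    then show ?thesis using P by linarith
  qed
  define G where "G xs = expected_charge d l B f (tl xs) {hd xs}" for xs
  define n where "n = (fact (card C) :: real)"
  have n: "n > 0" unfolding n_def by simp
  have "sum G ?\<Pi> = (\<Sum>z\<in>C. \<Sum>xs\<in>permutations_of_set (C - {z}). expected_charge d l B f xs {z})"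
    unfolding sum_permutations_of_set_Cons[OF assms(1) \<open>C \<noteq> {}\<close>] G_def by simp
  \<comment> \<open>There are \<open>fact (card C - 1)\<close> orders beginning with a given
    \<open>z\<close>, and \<open>card C\<close> choices of \<open>z\<close>, which together give
    \<open>n\<close>.\<close>
  also have "\<dots> \<le> (\<Sum>z\<in>C. fact (card C - 1) * (3 * f * real (card J) + 10 * Z))"
  proof (rule sum_mono)
    fix z assume z: "z \<in> C"
    then have "card (C - {z}) = card C - 1" by (simp add: card_Diff_singleton)
    then show "(\<Sum>xs\<in>permutations_of_set (C - {z}). expected_charge d l B f xs {z})
        \<le> fact (card C - 1) * (3 * f * real (card J) + 10 * Z)"
      using sum_random_order_expected_charge_le[OF assms(1,2) J(1) \<open>J \<noteq> {}\<close> l assms(5) f z P]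
      by simp
  qed
  also have "\<dots> = n * (3 * f * real (card J) + 10 * Z)"
    unfolding n_def using assms(1) \<open>C \<noteq> {}\<close> fact_reduce[of "card C", where 'a = real]
    by (simp add: card_gt_0_iff)
  also have "\<dots> \<le> n * (3 * f * real k + 10 * Z)"
    using n f J(3) by (intro mult_left_mono add_mono) auto
  also have "3 * f * real k = 3 * B" unfolding f_def using k by simp
  finally have G: "sum G ?\<Pi> \<le> n * (3 * B + 10 * Z)" .
  \<comment> \<open>Both claims are instances: for each fixed order the quantity \<open>h\<close> is
    bounded by an affine function of the expected charge. The size takes
    \<open>\<alpha> = 1\<close>, for the first agent, and \<open>\<beta> = 1 / f\<close>; the cost
    takes \<open>\<alpha> = 3 * B\<close> and \<open>\<beta> = 1\<close>.\<close>
  have expectation: "measure_pmf.expectation (meyerson_top_random_order C d k l B) h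
      \<le> \<alpha> + \<beta> * (3 * B + 10 * Z)"
    if \<beta>: "0 \<le> \<beta>" and h: "\<And>xs. xs \<in> ?\<Pi> \<Longrightarrow>
      measure_pmf.expectation (meyerson_loop d l B f (tl xs) {hd xs}) h \<le> \<alpha> + \<beta> * G xs"
    for h :: "'a set \<Rightarrow> real" and \<alpha> \<beta> :: real
  proof -
    have "measure_pmf.expectation (meyerson_top_random_order C d k l B) h
      = (\<Sum>xs\<in>?\<Pi>. measure_pmf.expectation (meyerson_loop d l B f (tl xs) {hd xs}) h / n)"
      unfolding meyerson_top_random_order_def n_def using assms(1)
      by (subst pmf_expectation_bind_pmf_of_set)
        (auto simp: meyerson_top_def f_def finite_set_pmf_meyerson_loop field_simps)
    also have "\<dots> \<le> (\<Sum>xs\<in>?\<Pi>. (\<alpha> + \<beta> * G xs) / n)"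
      using h n by (intro sum_mono divide_right_mono) auto
    also have "\<dots> = \<alpha> + \<beta> * (sum G ?\<Pi> / n)"
      using n assms(1)
      by (simp add: sum_divide_distrib[symmetric] sum.distrib sum_distrib_left[symmetric]
          add_divide_distrib n_def)
    also have "\<dots> \<le> \<alpha> + \<beta> * (3 * B + 10 * Z)"
      using G n \<beta> by (intro add_left_mono mult_left_mono) (auto simp: field_simps)
    finally show ?thesis .
  qed
  have perm: "xs \<noteq> [] \<and> set (tl xs) \<subseteq> C \<and> distinct (tl xs) \<and> hd xs \<in> C
      \<and> C = insert (hd xs) (set (tl xs)) \<and> hd xs \<notin> set (tl xs)"
    if "xs \<in> ?\<Pi>" for xs
  proof (cases xs)
    case Nil
    then show ?thesis using permutations_of_setD[OF that] \<open>C \<noteq> {}\<close> by simp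
  next
    case (Cons y ys)
    then show ?thesis using permutations_of_setD[OF that] by auto
  qed
  have "measure_pmf.expectation (meyerson_top_random_order C d k l B) (\<lambda>S. real (card S))
      \<le> 1 + 1 / f * (3 * B + 10 * Z)"
    using f expectation_card_meyerson_loop[OF f, of "{hd _}" d l B "tl _"]
    by (intro expectation) (auto simp: G_def)
  \<comment> \<open>\<open>OPT \<le> B\<close> turns the total charge into \<open>13 * B\<close>,
    and \<open>B / f = k\<close>; the final \<open>1 + 13 * k\<close> is below \<open>26 * k\<close>
    as \<open>k \<ge> 1\<close>.\<close>
  also have "\<dots> \<le> 1 + 1 / f * (13 * B)"
    using f assms(6) unfolding Z_def by (intro add_left_mono mult_left_mono) auto
  also have "1 / f * (13 * B) = 13 * real k" unfolding f_def using k assms(5) by simp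
  also have "1 + 13 * real k \<le> 26 * real k" using k by linarith
  finally have card: "measure_pmf.expectation (meyerson_top_random_order C d k l B)
      (\<lambda>S. real (card S)) \<le> 26 * real k" .
  have "measure_pmf.expectation (meyerson_top_random_order C d k l B) (top_cost C d l)
      \<le> 3 * B + 1 * (3 * B + 10 * Z)"
  proof (rule expectation)
    fix xs assume xs: "xs \<in> ?\<Pi>"
    let ?M = "meyerson_loop d l B f (tl xs) {hd xs}"
    note fin = finite_set_pmf_meyerson_loop
    let ?h = "\<lambda>T. \<Sum>x\<in>set (tl xs). meyerson_delta d l B T x"
    have "measure_pmf.expectation ?M (top_cost C d l) \<le> measure_pmf.expectation ?M (\<lambda>T. 3 * B + ?h T)"
    proof (rule expectation_mono_pmf[OF fin])
      fix T assume "T \<in> set_pmf ?M"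
      from meyerson_loop_supset[OF this] have T: "hd xs \<in> T" "T \<subseteq> C"
        using perm[OF xs] by auto
      have "finite T" using assms(1) T(2) by (rule rev_finite_subset)
      \<comment> \<open>The threshold is the one in the excess of the algorithm, so the
        \<open>l\<close> largest distances cost \<open>3 * B\<close> plus the total excess.\<close>
      have "top_cost C d l T \<le> real l * (3 * (B / real l))
          + (\<Sum>x\<in>C. max (setdist_min d x T - 3 * (B / real l)) 0)"
        unfolding top_cost_def using assms(5) by (intro Top_le_threshold[OF assms(1)]) simp
      also have "\<dots> = 3 * B + (\<Sum>x\<in>C. meyerson_delta d l B T x)"
        unfolding meyerson_delta_def using l by simp
      also have "(\<Sum>x\<in>C. meyerson_delta d l B T x) = meyerson_delta d l B T (hd xs) + ?h T"
        using perm[OF xs] by (metis List.finite_set sum.insert)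
      also have "meyerson_delta d l B T (hd xs) = 0"
        using assms(5) by (intro meyerson_delta_self[OF assms(2) \<open>finite T\<close> T(2,1)]) simp
      finally show "top_cost C d l T \<le> 3 * B + ?h T" by simp
    qed
    also have "\<dots> = 3 * B + measure_pmf.expectation ?M ?h"
      by (subst Bochner_Integration.integral_add) (auto intro: integrable_measure_pmf_finite fin)
    also have "measure_pmf.expectation ?M ?h \<le> G xs"
      unfolding G_def using perm[OF xs] assms(5)
      by (intro expectation_delta_meyerson_loop[OF f _ assms(2)]) auto
    finally show "measure_pmf.expectation ?M (top_cost C d l) \<le> 3 * B + 1 * G xs" by simp
  qed simp
  \<comment> \<open>The left side is \<open>6 * B + 10 * Z\<close>.\<close>
  also have "\<dots> \<le> 15 * B + 14 * Z" using assms(5) \<open>0 \<le> Z\<close> by simp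
  finally show ?thesis using card unfolding Z_def by simp
qed

end
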